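(* For $g\ge 0$ and $\alpha$ a partition of $n\ge 1$ with $m$ parts, $$a_g(\alpha)=\frac{1}{n!\,(2n-1)^{n+m-3+2g}}\;b_g(\alpha\cup 1^{n-1}).$$
   Context: $\mathfrak{S}_n$ is the symmetric group on $[n]=\{1,\ldots,n\}$. $\mathcal{K}_\alpha$ is the conjugacy class of permutations in $\mathfrak{S}_n$ with cycle type the partition $\alpha$ of $n$. $\alpha\cup 1^{n-1}$ denotes the partition of $2n-1$, with $m+n-1$ parts, obtained by inserting $n-1$ additional parts equal to $1$ into $\alpha$. Star factorization number $a_g(\alpha)$: for a partition $\alpha$ of $n$ with $m$ parts and $g\ge0$, $a_g(\alpha)$ is the number, for each fixed $\sigma\in\mathcal{K}_\alpha$, of tuples $(\tau_1,\ldots,\tau_r)$ with $r=n+m-2+2g$, where each $\tau_j$ is a transposition of the form $(i\,n)$ with $i\in[n-1]$ (a star transposition with pivot $n$), such that $\tau_1\cdots\tau_r=\sigma$ and the group generated by $\tau_1,\ldots,\tau_r$ acts transitively on $[n]$. (This number is the same for every $\sigma\in\mathcal{K}_\alpha$. Equivalently, $a_g(\alpha)$ is the coefficient of $\mathsf{K}_\alpha=\sum_{\pi\in\mathcal{K}_\alpha}\pi$ in the sum, in $\mathbb{C}\mathfrak{S}_n$, of all products $(i_1\,n)\cdots(i_r\,n)$ whose factors generate a transitive group on $[n]$.) The number $b_g(\alpha)$: for a partition $\alpha$ of a positive integer $N$ with $M$ parts and $g\ge0$, $b_g(\alpha)$ is the number, for each fixed $\sigma\in\mathcal{K}_\alpha\subset\mathfrak{S}_N$,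 of factorizations of $\sigma$ as an ordered product $\tau_1\cdots\tau_{s}\,c$ with $s=M-1+2g$, where $\tau_1,\ldots,\tau_s$ are arbitrary transpositions in $\mathfrak{S}_N$ and $c$ is an $N$-cycle. Equivalently, it is the coefficient of $\mathsf{K}_\alpha$ in $\mathsf{K}_{(1^{N-2}\,2)}^{\,s}\,\mathsf{K}_{(N)}$ in $\mathbb{C}\mathfrak{S}_N$. (In terms of double Hurwitz numbers, $b_g(\alpha)=\alpha_1\cdots\alpha_M H^g_{(N),\alpha}$.) *)

theory Defs
  imports Complex_Main "HOL-Library.Multiset" "HOL-Combinatorics.Orbits" "HOL-Algebra.Sym_Groups"
begin

definition is_partition :: "nat multiset \<Rightarrow> nat \<Rightarrow> bool"
  where "is_partition \<alpha> n \<longleftrightarrow> 0 \<notin># \<alpha> \<and> sum_mset \<alpha> = n"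

(* On a permutation, Orbits.orbit p x is the support of the cycle through x. It contains x,
   so fixed points contribute parts equal to 1. *)
definition cycle_type :: "nat \<Rightarrow> (nat \<Rightarrow> nat) \<Rightarrow> nat multiset"
  where "cycle_type n p = image_mset card (mset_set (Orbits.orbit p ` {1..n}))"

definition conj_class :: "nat \<Rightarrow> nat multiset \<Rightarrow> (nat \<Rightarrow> nat) set"
  where "conj_class n \<alpha> = {p \<in> carrier (sym_group n). cycle_type n p = \<alpha>}"

definition star_transpositions :: "nat \<Rightarrow> (nat \<Rightarrow> nat) set"
  where "star_transpositions n = {transpose i n |i. i \<in> {1..n-1}}"

definition transpositions :: "nat \<Rightarrow> (nat \<Rightarrow> nat) set"
  where "transpositions n = {transpose i j |i j. i \<in> {1..n} \<and> j \<in> {1..n} \<and> i \<noteq> j}"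

definition acts_transitively :: "nat \<Rightarrow> (nat \<Rightarrow> nat) set \<Rightarrow> bool"
  where "acts_transitively n G \<longleftrightarrow> (\<forall>x\<in>{1..n}. \<forall>y\<in>{1..n}. \<exists>p\<in>G. p x = y)"

(* The product t_1 ... t_r as a composition of functions (the rightmost factor acts first). *)
definition perm_product :: "(nat \<Rightarrow> nat) list \<Rightarrow> nat \<Rightarrow> nat"
  where "perm_product ts = foldr (\<circ>) ts id"

(* For s in conj_class n \<alpha>, the cardinality of this set is a_g(\<alpha>). The truncated
   subtraction in the length is harmless, as n and size \<alpha> are positive. *)
definition star_factorizations ::
  "nat \<Rightarrow> nat \<Rightarrow> nat multiset \<Rightarrow> (nat \<Rightarrow> nat) \<Rightarrow> (nat \<Rightarrow> nat) list set"
  where "star_factorizations g n \<alpha> s =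
    {ts. length ts = n + size \<alpha> - 2 + 2 * g \<and> set ts \<subseteq> star_transpositions n \<and>
         perm_product ts = s \<and> acts_transitively n (generate (sym_group n) (set ts))}"

(* For s in conj_class n \<alpha>, the cardinality of this set is b_g(\<alpha>). *)
definition cycle_factorizations ::
  "nat \<Rightarrow> nat \<Rightarrow> nat multiset \<Rightarrow> (nat \<Rightarrow> nat) \<Rightarrow> ((nat \<Rightarrow> nat) list \<times> (nat \<Rightarrow> nat)) set"
  where "cycle_factorizations g n \<alpha> s =
    {(ts, c). length ts = size \<alpha> - 1 + 2 * g \<and> set ts \<subseteq> transpositions n \<and>
              c \<in> conj_class n {#n#} \<and> perm_product ts \<circ> c = s}"

end

theory Submission
  imports Defs "HOL-Computational_Algebra.Formal_Power_Series"
begin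

text \<open>
  Put \<open>S k = exp (k t / 2) - exp (- k t / 2)\<close> and let \<open>P\<close> be the product of \<open>S (card c)\<close> over
  the cycles \<open>c\<close> of a permutation \<open>f\<close>. Multiplying \<open>f\<close> by a transposition cuts a cycle in
  two or joins two cycles, so the sum of \<open>P\<close> over the products of \<open>f\<close> with all transpositions
  moving a given point can be evaluated with the addition theorem and a telescoping sum. Removing
  the first factor of a factorization therefore becomes a differential equation for the exponential
  generating function by the number of transpositions. Its solution is \<open>S 1 ^ (n - 2) * P / n!\<close>
  for transitive star factorizations, and \<open>P / (N * S 1)\<close> with \<open>t\<close> replaced by \<open>N * t\<close> for
  factorizations with an \<open>N\<close>-cycle. Adding \<open>n - 1\<close> fixed points multiplies \<open>P\<close> by
  \<open>S 1 ^ (n - 1)\<close>, so the two series agree up to the stated factor.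
\<close>

section \<open>Hyperbolic sines as formal power series\<close>

text \<open>This is \<open>S k\<close> of the introduction. With k-th powers in place of
  \<open>fps_exp (k/2)\<close>, identities in k become polynomial identities in two mutually inverse
  series.\<close>

definition two_sinh :: "nat \<Rightarrow> real fps"
  where "two_sinh k = fps_exp (1/2) ^ k - fps_exp (- 1/2) ^ k"

definition two_cosh :: "nat \<Rightarrow> real fps"
  where "two_cosh k = fps_exp (1/2) ^ k + fps_exp (- 1/2) ^ k"

lemma fps_exp_half_inverse: "fps_exp (1/2) * fps_exp (- 1/2 :: real) = 1"
  by (simp flip: fps_exp_add_mult)

lemma two_sinh_0 [simp]: "two_sinh 0 = 0"
  by (simp add: two_sinh_def)

lemma two_sinh_nth_0 [simp]: "fps_nth (two_sinh k) 0 = 0"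
  by (simp add: two_sinh_def fps_exp_power_mult)

text \<open>The coefficient of t is k. Every later cancellation of \<open>two_sinh 1\<close> rests
  on this.\<close>

lemma two_sinh_nz: "k > 0 \<Longrightarrow> two_sinh k \<noteq> 0"
proof
  assume "k > 0" "two_sinh k = 0"
  then have "fps_nth (two_sinh k) 1 = 0" by simp
  with \<open>k > 0\<close> show False by (simp add: two_sinh_def fps_exp_power_mult)
qed

lemma deriv_two_sinh: "2 * fps_deriv (two_sinh k) = of_nat k * two_cosh k"
proof -
  have "fps_const 2 * fps_deriv (two_sinh k) = fps_const (real k) * two_cosh k"
    by (simp add: two_sinh_def two_cosh_def fps_exp_power_mult fps_eq_iff field_simps)
  then show ?thesis by (simp add: fps_of_nat flip: numeral_fps_const)
qed

lemma two_sinh_add: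
  "2 * two_sinh (j + k) = two_sinh j * two_cosh k + two_cosh j * two_sinh k"
  by (simp add: two_sinh_def two_cosh_def power_add algebra_simps)

text \<open>The subtraction theorem for the arguments \<open>Suc k\<close> and 1: after expansion
  the mixed terms contain the product of the two inverse exponentials, which is 1.\<close>

lemma two_sinh_Suc_diff:
  "2 * two_sinh k = two_sinh (Suc k) * two_cosh 1 - two_cosh (Suc k) * two_sinh 1"
proof -
  let ?x = "fps_exp (1/2) :: real fps" and ?y = "fps_exp (- 1/2) :: real fps"
  have "two_sinh (Suc k) * two_cosh 1 - two_cosh (Suc k) * two_sinh 1
        = 2 * ((?x * ?y) * (?x ^ k - ?y ^ k))"
    by (simp add: two_sinh_def two_cosh_def algebra_simps)
  then show ?thesis by (simp only: fps_exp_half_inverse two_sinh_def mult_1_left)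
qed

text \<open>The quotient of \<open>two_sinh k\<close> by \<open>two_sinh 1\<close>, written as a
  geometric sum so that its constant term k is visible without any division of series.\<close>

definition sinh_ratio :: "nat \<Rightarrow> real fps"
  where "sinh_ratio k = (\<Sum>i<k. fps_exp (- 1/2) ^ (k - Suc i) * fps_exp (1/2) ^ i)"

lemma two_sinh_eq_ratio: "two_sinh k = two_sinh 1 * sinh_ratio k"
  using power_diff_sumr2[of "fps_exp (1/2) :: real fps" k "fps_exp (- 1/2)"]
  by (simp add: two_sinh_def sinh_ratio_def)

lemma sinh_ratio_nth_0: "fps_nth (sinh_ratio k) 0 = real k"
  by (simp add: sinh_ratio_def fps_sum_nth fps_exp_power_mult)

text \<open>Each product expands into \<open>two_cosh k\<close> minus two mixed terms. The mixed
  terms form geometric sums, which collapse after multiplication by \<open>two_sinh 1\<close>. The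
  index l will be the length of one piece of a cut cycle of length k.\<close>

lemma two_sinh_convolution:
  assumes "k > 0"
  shows "two_sinh 1 * (\<Sum>l\<in>{1..<k}. two_sinh l * two_sinh (k - l))
         = of_nat k * two_sinh 1 * two_cosh k - two_sinh k * two_cosh 1"
proof -
  let ?x = "fps_exp (1/2) :: real fps" and ?y = "fps_exp (- 1/2) :: real fps"
  \<comment> \<open>With the term for l = k added, the sum is x times the cofactor of x - y in
    \<open>x ^ k - y ^ k\<close>.\<close>
  have geometric: "(x - y) * (\<Sum>l\<in>{1..<k}. x ^ l * y ^ (k - l)) = x ^ k * y - x * y ^ k"
    for x y :: "real fps"
  proof -
    have "x * (\<Sum>i<k. y ^ (k - Suc i) * x ^ i) = (\<Sum>i<k. x ^ Suc i * y ^ (k - Suc i))"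
      by (simp add: sum_distrib_left algebra_simps)
    also have "\<dots> = (\<Sum>l\<in>{1..<Suc k}. x ^ l * y ^ (k - l))"
      using sum.shift_bounds_Suc_ivl[of "\<lambda>l. x ^ l * y ^ (k - l)" 0 k]
      by (simp add: lessThan_atLeast0)
    also have "\<dots> = (\<Sum>l\<in>{1..<k}. x ^ l * y ^ (k - l)) + x ^ k"
      using assms by (simp add: sum.atLeastLessThan_Suc)
    finally have "(\<Sum>l\<in>{1..<k}. x ^ l * y ^ (k - l)) = x * (\<Sum>i<k. y ^ (k - Suc i) * x ^ i) - x ^ k"
      by simp
    then have "(x - y) * (\<Sum>l\<in>{1..<k}. x ^ l * y ^ (k - l))
        = (x - y) * (x * (\<Sum>i<k. y ^ (k - Suc i) * x ^ i) - x ^ k)" by (rule arg_cong)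
    also have "\<dots> = x * ((x - y) * (\<Sum>i<k. y ^ (k - Suc i) * x ^ i)) - (x - y) * x ^ k"
      by (simp only: right_diff_distrib mult.left_commute)
    also have "\<dots> = x * (x ^ k - y ^ k) - (x - y) * x ^ k"
      by (simp only: power_diff_sumr2)
    finally show ?thesis by (simp add: algebra_simps)
  qed
  have "two_sinh l * two_sinh (k - l)
      = two_cosh k - ?x ^ l * ?y ^ (k - l) - ?y ^ l * ?x ^ (k - l)" if "l \<in> {1..<k}" for l
  proof -
    have "a ^ l * a ^ (k - l) = a ^ k" for a :: "real fps"
      using that by (simp flip: power_add)
    from this[of ?x] this[of ?y] show ?thesis
      by (simp add: two_sinh_def two_cosh_def algebra_simps)
  qed
  then have "(\<Sum>l\<in>{1..<k}. two_sinh l * two_sinh (k - l))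
      = (\<Sum>l\<in>{1..<k}. two_cosh k - ?x ^ l * ?y ^ (k - l) - ?y ^ l * ?x ^ (k - l))"
    by (intro sum.cong refl)
  also have "\<dots> = (of_nat k - 1) * two_cosh k - (\<Sum>l\<in>{1..<k}. ?x ^ l * ?y ^ (k - l))
        - (\<Sum>l\<in>{1..<k}. ?y ^ l * ?x ^ (k - l))"
    using assms by (simp add: sum_subtractf of_nat_diff)
  finally have "two_sinh 1 * (\<Sum>l\<in>{1..<k}. two_sinh l * two_sinh (k - l))
      = two_sinh 1 * ((of_nat k - 1) * two_cosh k - (\<Sum>l\<in>{1..<k}. ?x ^ l * ?y ^ (k - l))
        - (\<Sum>l\<in>{1..<k}. ?y ^ l * ?x ^ (k - l)))" by (rule arg_cong)
  \<comment> \<open>The sign is moved into the second factor \<open>?y - ?x\<close>, so that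
    \<open>geometric\<close> also applies with the two exponentials exchanged.\<close>
  also have "\<dots> = (of_nat k - 1) * two_sinh 1 * two_cosh k
        - (?x - ?y) * (\<Sum>l\<in>{1..<k}. ?x ^ l * ?y ^ (k - l))
        + (?y - ?x) * (\<Sum>l\<in>{1..<k}. ?y ^ l * ?x ^ (k - l))"
  proof -
    have "(a - b) * (n * c - u - v) = n * (a - b) * c - (a - b) * u + (b - a) * v"
      for a b c n u v :: "real fps" by (simp add: algebra_simps)
    then show ?thesis by (simp only: two_sinh_def power_one_right)
  qed
  also have "\<dots> = (of_nat k - 1) * two_sinh 1 * two_cosh k
        - (?x ^ k * ?y - ?x * ?y ^ k) + (?y ^ k * ?x - ?y * ?x ^ k)"
    by (simp only: geometric)
  also have "\<dots> = of_nat k * two_sinh 1 * two_cosh k - two_sinh k * two_cosh 1"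
    by (simp add: two_sinh_def two_cosh_def algebra_simps)
  finally show ?thesis .
qed

section \<open>Orbits after multiplication by a transposition\<close>

text \<open>A point lies on its own cycle under a permutation, so there is a first return time; the
  iterates before it are distinct and exhaust the cycle. Hence the cardinality is the return
  time.\<close>

lemma orbit_bij_betw:
  fixes x :: 'a
  assumes "permutation f"
  defines "k \<equiv> card (orbit f x)"
  shows "bij_betw (\<lambda>n. (f ^^ n) x) {..<k} (orbit f x)" and "(f ^^ k) x = x" and "k > 0"
proof -
  have self: "x \<in> orbit f x" using assms(1) by (rule permutation_self_in_orbit)
  let ?d = "funpow_dist1 f x x"
  have bij: "bij_betw (\<lambda>n. (f ^^ n) x) {..<?d} (orbit f x)"
    using inj_on_funpow_dist1[OF self] orbit_conv_funpow_dist1[OF self]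
    by (simp add: bij_betw_def lessThan_atLeast0)
  then have "k = ?d"
    by (simp add: k_def bij_betw_same_card[symmetric])
  then show "bij_betw (\<lambda>n. (f ^^ n) x) {..<k} (orbit f x)" "(f ^^ k) x = x" "k > 0"
    using bij funpow_dist1_prop[OF self] by auto
qed

lemma funpow_eq_iff_less_card:
  assumes "permutation f" "m < card (orbit f x)" "n < card (orbit f x)"
  shows "(f ^^ m) x = (f ^^ n) x \<longleftrightarrow> m = n"
  using orbit_bij_betw(1)[OF assms(1), of x] assms(2,3)
  by (auto simp: bij_betw_def inj_on_def)

text \<open>The map \<open>g\<close> follows \<open>f\<close> except that the values x and
  \<open>(f ^^ l) x\<close> are exchanged. Starting at x, the path is sent back to x just before it
  would reach \<open>(f ^^ l) x\<close>; starting there, it is sent back just before it would reach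
  x.\<close>

lemma orbit_comp_transpose_cut:
  assumes f: "permutation f" and l: "0 < l" "l < card (orbit f x)"
  defines "g \<equiv> transpose x ((f ^^ l) x) \<circ> f"
  shows "orbit g x = (\<lambda>n. (f ^^ n) x) ` {..<l}"
    and "orbit g ((f ^^ l) x) = (\<lambda>n. (f ^^ n) x) ` {l..<card (orbit f x)}"
proof -
  let ?k = "card (orbit f x)"
  note inj = funpow_eq_iff_less_card[OF f, of _ x]
  have return: "(f ^^ ?k) x = x" using f by (rule orbit_bij_betw)
  have ne: "(f ^^ n) x \<noteq> x" if "0 < n" "n < ?k" for n
    using inj[of n 0] that by auto
  have 1: "(g ^^ n) x = (f ^^ n) x" if "n < l" for n
    using that
  proof (induction n)
    case (Suc n)
    then show ?case using ne[of "Suc n"] inj[of "Suc n" l] l by (simp add: g_def transpose_def)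
  qed simp
  obtain l' where l': "l = Suc l'" using l by (cases l) auto
  have "(g ^^ l) x = x" using 1[of l'] by (simp add: l' g_def)
  \<comment> \<open>Any positive return time gives a bounded description of the orbit; below l the
    iterates of \<open>g\<close> and \<open>f\<close> agree.\<close>
  then have "orbit g x = {(g ^^ n) x |n. n < l}" using l by (simp add: orbit_altdef_bounded)
  also have "\<dots> = {(f ^^ n) x |n. n < l}" using 1 by metis
  finally show "orbit g x = (\<lambda>n. (f ^^ n) x) ` {..<l}" by auto
  have 2: "(g ^^ n) ((f ^^ l) x) = (f ^^ (n + l)) x" if "n < ?k - l" for n
    using that
  proof (induction n)
    case (Suc n)
    then show ?case using ne[of "Suc n + l"] inj[of "Suc n + l" l] l
      by (simp add: g_def transpose_def)
  qed simp
  obtain k' where k': "?k - l = Suc k'" using l by (cases "?k - l") auto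
  then have "f ((f ^^ (k' + l)) x) = x" using return l
    by (metis add_Suc funpow.simps(2) comp_apply le_add_diff_inverse2 less_imp_le)
  then have "(g ^^ (?k - l)) ((f ^^ l) x) = (f ^^ l) x"
    using 2[of k'] by (simp add: k' g_def)
  then have "orbit g ((f ^^ l) x) = {(g ^^ n) ((f ^^ l) x) |n. n < ?k - l}"
    using l by (simp add: orbit_altdef_bounded)
  also have "\<dots> = {(f ^^ (n + l)) x |n. n < ?k - l}" using 2 by metis
  also have "\<dots> = (\<lambda>n. (f ^^ n) x) ` {l..<?k}"
  proof (intro equalityI subsetI)
    fix z assume "z \<in> (\<lambda>n. (f ^^ n) x) ` {l..<?k}"
    then obtain n where "z = (f ^^ n) x" "l \<le> n" "n < ?k" by auto
    then show "z \<in> {(f ^^ (n + l)) x |n. n < ?k - l}"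
      by (intro CollectI exI[of _ "n - l"]) auto
  qed auto
  finally show "orbit g ((f ^^ l) x) = (\<lambda>n. (f ^^ n) x) ` {l..<?k}" .
qed

text \<open>Along the cycle of x neither x nor y is met as a value before the last step, so
  \<open>g\<close> follows \<open>f\<close> up to there. The last step, which would return to x,
  leads to y.\<close>

lemma orbit_subset_orbit_comp_transpose:
  assumes f: "permutation f" and y: "y \<notin> orbit f x"
  defines "g \<equiv> transpose x y \<circ> f"
  shows "orbit f x \<subseteq> orbit g x" and "y \<in> orbit g x"
proof -
  let ?k = "card (orbit f x)"
  have g: "permutation g" 
    unfolding g_def using f by (simp add: permutation_compose permutation_swap_id)
  have in_orbit: "(f ^^ n) x \<in> orbit g x" if "n < ?k" for n
    using that
  proof (induction n)
    case 0
    then show ?case using g by (simp add: permutation_self_in_orbit)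
  next
    case (Suc n)
    then have "(f ^^ Suc n) x \<noteq> x"
      using funpow_eq_iff_less_card[OF f, of "Suc n" x 0] by auto
    moreover have "(f ^^ Suc n) x \<noteq> y"
      using y f by (metis funpow_in_orbit permutation_self_in_orbit)
    ultimately have "(f ^^ Suc n) x = g ((f ^^ n) x)" by (simp add: g_def transpose_def)
    then show ?case using Suc by (auto intro: orbit.step)
  qed
  have "orbit f x = (\<lambda>n. (f ^^ n) x) ` {..<?k}"
    using orbit_bij_betw(1)[OF f, of x] by (simp add: bij_betw_def)
  then show "orbit f x \<subseteq> orbit g x" using in_orbit by (metis image_subsetI lessThan_iff)
  obtain k' where k': "?k = Suc k'" using orbit_bij_betw(3)[OF f, of x] by (cases ?k) auto
  then have "g ((f ^^ k') x) = y"
    using orbit_bij_betw(2)[OF f, of x] by (simp add: g_def)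
  then show "y \<in> orbit g x" using in_orbit[of k'] k' by (metis lessI orbit.step)
qed

lemma orbit_comp_transpose_other:
  assumes f: "permutation f" and "x \<notin> orbit f z" "y \<notin> orbit f z"
  shows "orbit (transpose x y \<circ> f) z = orbit f z"
proof (rule orbit_cong)
  show "z \<in> orbit f z" using f by (rule permutation_self_in_orbit)
  show "(transpose x y \<circ> f) s = f s" if "s \<in> orbit f z" for s
    using assms(2,3) orbit.step[OF that] by (auto simp: transpose_def)
qed

text \<open>By symmetry of the transposition the path from x runs through its old cycle to y and
  then through the cycle of y. Conversely, the union of both cycles is closed under
  \<open>g\<close>.\<close>

lemma orbit_comp_transpose_join:
  assumes f: "permutation f" and y: "y \<notin> orbit f x"
  defines "g \<equiv> transpose x y \<circ> f"
  shows "orbit g x = orbit f x \<union> orbit f y"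
proof
  have x: "x \<notin> orbit f y"
    using y f by (meson orbit_swap permutation_self_in_orbit)
  have self: "z \<in> orbit f z" for z using f by (rule permutation_self_in_orbit)
  show "orbit f x \<union> orbit f y \<subseteq> orbit g x"
    using orbit_subset_orbit_comp_transpose[OF f y] orbit_subset_orbit_comp_transpose(1)[OF f x]
    by (auto simp: g_def transpose_commute[of y x] intro: orbit_trans)
  have step: "g z \<in> orbit f x \<union> orbit f y" if "z \<in> orbit f x \<union> orbit f y" for z
    using that self by (auto simp: g_def transpose_def intro: orbit.step)
  show "orbit g x \<subseteq> orbit f x \<union> orbit f y"
  proof
    fix z assume "z \<in> orbit g x"
    then show "z \<in> orbit f x \<union> orbit f y"
      by induction (use step self in blast)+
  qed
qed

lemma orbit_eq_iff_mem:
  assumes "permutation f"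
  shows "orbit f z = orbit f x \<longleftrightarrow> z \<in> orbit f x"
proof
  assume "orbit f z = orbit f x"
  then show "z \<in> orbit f x" using permutation_self_in_orbit[OF assms, of z] by simp
next
  assume "z \<in> orbit f x"
  then show "orbit f z = orbit f x" by (rule orbit_cyclic_eq3[OF cyclic_on_orbit'[OF assms]])
qed

lemma orbit_image_outside:
  assumes "permutation f"
  shows "orbit f ` (X - orbit f x) = orbit f ` X - {orbit f x}"
proof -
  have "X - orbit f x = {z \<in> X. orbit f z \<noteq> orbit f x}"
    by (auto simp: orbit_eq_iff_mem[OF assms])
  then show ?thesis by auto
qed

lemma orbit_disjoint:
  assumes "permutation f" "orbit f z \<noteq> orbit f x"
  shows "orbit f z \<inter> orbit f x = {}"
  using assms(2) orbit_eq_iff_mem[OF assms(1)] by (metis disjoint_iff)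

lemma orbit_image_orbit:
  assumes "permutation f"
  shows "orbit f ` orbit f x = {orbit f x}"
proof -
  have "orbit f z = orbit f x" if "z \<in> orbit f x" for z
    using that by (simp only: orbit_eq_iff_mem[OF assms])
  then have "orbit f ` orbit f x = (\<lambda>_. orbit f x) ` orbit f x" by (rule image_cong[OF refl])
  then show ?thesis by (simp only: image_constant_conv orbit_nonempty if_False)
qed

lemma fibre_orbit:
  assumes "finite X" "f permutes X" "x \<in> X"
  shows "{z \<in> X. orbit f z = orbit f x} = orbit f x"
  using permutes_orbit_subset[OF assms(2,3)]
  by (auto simp: orbit_eq_iff_mem[OF permutes_imp_permutation[OF assms(1,2)]])

text \<open>Naming both cycles lets one statement serve cuts and joins: for a cut the two
  coincide.\<close>

lemma orbit_comp_transpose_image_outside: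
  assumes f: "permutation f" 
  shows "orbit (transpose x y \<circ> f) ` (X - (orbit f x \<union> orbit f y)) = 
    orbit f ` X - {orbit f x, orbit f y}"
proof -
  have outside: "X - (orbit f x \<union> orbit f y) = {z \<in> X. orbit f z \<noteq> orbit f x \<and> orbit f z \<noteq> orbit f y}"
    by (auto simp: orbit_eq_iff_mem[OF f])
  have "orbit (transpose x y \<circ> f) z = orbit f z" if "z \<in> X - (orbit f x \<union> orbit f y)" for z
  proof (rule orbit_comp_transpose_other[OF f])
    show "x \<notin> orbit f z" "y \<notin> orbit f z"
      using that unfolding outside by (metis (mono_tags, lifting) mem_Collect_eq orbit_eq_iff_mem[OF f])+
  qed
  then have "orbit (transpose x y \<circ> f) ` (X - (orbit f x \<union> orbit f y))
      = orbit f ` (X - (orbit f x \<union> orbit f y))" by (rule image_cong[OF refl])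
  also have "\<dots> = orbit f ` X - {orbit f x, orbit f y}"
    unfolding outside by auto
  finally show ?thesis .
qed

lemma orbits_comp_transpose_cut:
  assumes X: "finite X" "f permutes X" "x \<in> X" and l: "0 < l" "l < card (orbit f x)"
  shows "orbit (transpose x ((f ^^ l) x) \<circ> f) ` X =
    insert ((\<lambda>n. (f ^^ n) x) ` {..<l})
      (insert ((\<lambda>n. (f ^^ n) x) ` {l..<card (orbit f x)}) (orbit f ` X - {orbit f x}))"
proof -
  define y where "y = (f ^^ l) x"
  define g where "g = transpose x y \<circ> f"
  have f: "permutation f" using X(1,2) by (rule permutes_imp_permutation)
  have g: "permutation g"
    unfolding g_def using f by (simp add: permutation_compose permutation_swap_id)
  have y: "y \<in> orbit f x" 
    unfolding y_def using f by (simp add: funpow_in_orbit permutation_self_in_orbit)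
  then have orbit_y: "orbit f y = orbit f x" by (simp add: orbit_eq_iff_mem[OF f])
  have gx: "orbit g x = (\<lambda>n. (f ^^ n) x) ` {..<l}"
    and gy: "orbit g y = (\<lambda>n. (f ^^ n) x) ` {l..<card (orbit f x)}"
    unfolding g_def y_def using orbit_comp_transpose_cut[OF f l] by auto
  \<comment> \<open>The two new cycles partition the old one, so \<open>X\<close> consists of them
    and of the points on untouched cycles.\<close>
  have "{..<l} \<union> {l..<card (orbit f x)} = {..<card (orbit f x)}" using l by auto
  then have union: "orbit f x = orbit g x \<union> orbit g y"
    using orbit_bij_betw(1)[OF f, of x] by (simp add: gx gy bij_betw_def flip: image_Un)
  have "X = (orbit g x \<union> orbit g y) \<union> (X - (orbit f x \<union> orbit f y))"
    unfolding union[symmetric] orbit_y using permutes_orbit_subset[OF X(2,3)] by auto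
  moreover have "orbit g ` (orbit g x \<union> orbit g y) = {orbit g x, orbit g y}"
    by (auto simp: image_Un orbit_image_orbit[OF g])
  ultimately have "orbit g ` X = {orbit g x, orbit g y} \<union> orbit g ` (X - (orbit f x \<union> orbit f y))"
    by (metis image_Un)
  also have "orbit g ` (X - (orbit f x \<union> orbit f y)) = orbit f ` X - {orbit f x}"
    unfolding g_def orbit_comp_transpose_image_outside[OF f] by (simp add: orbit_y)
  finally have "orbit g ` X = insert (orbit g x) (insert (orbit g y) (orbit f ` X - {orbit f x}))"
    by auto
  then show ?thesis unfolding gx gy unfolding g_def y_def .
qed

lemma orbits_comp_transpose_join:
  assumes X: "finite X" "f permutes X" "x \<in> X" "y \<in> X" and y: "y \<notin> orbit f x"
  shows "orbit (transpose x y \<circ> f) ` X =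
    insert (orbit f x \<union> orbit f y) (orbit f ` X - {orbit f x, orbit f y})"
proof -
  define g where "g = transpose x y \<circ> f"
  have f: "permutation f" using X(1,2) by (rule permutes_imp_permutation)
  have g: "permutation g"
    unfolding g_def using f by (simp add: permutation_compose permutation_swap_id)
  have gx: "orbit g x = orbit f x \<union> orbit f y"
    unfolding g_def using f y by (rule orbit_comp_transpose_join)
  have "X = orbit g x \<union> (X - (orbit f x \<union> orbit f y))"
    unfolding gx using permutes_orbit_subset[OF X(2,3)] permutes_orbit_subset[OF X(2,4)] by auto
  moreover have "orbit g ` orbit g x = {orbit g x}"
    by (auto simp: image_Un orbit_image_orbit[OF g])
  ultimately have "orbit g ` X = {orbit g x} \<union> orbit g ` (X - (orbit f x \<union> orbit f y))"
    by (metis image_Un)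
  then show ?thesis
    by (simp add: g_def orbit_comp_transpose_image_outside[OF f] gx[unfolded g_def])
qed

section \<open>Products of hyperbolic sines over cycles\<close>

definition cycle_prod :: "'a set \<Rightarrow> ('a \<Rightarrow> 'a) \<Rightarrow> real fps"
  where "cycle_prod X f = (\<Prod>c\<in>orbit f ` X. two_sinh (card c))"

definition cycle_prod_except :: "'a set \<Rightarrow> ('a \<Rightarrow> 'a) \<Rightarrow> 'a \<Rightarrow> real fps"
  where "cycle_prod_except X f x = (\<Prod>c\<in>orbit f ` X - {orbit f x}. two_sinh (card c))"

lemma cycle_prod_split:
  assumes "finite X" "x \<in> X"
  shows "cycle_prod X f = two_sinh (card (orbit f x)) * cycle_prod_except X f x"
  unfolding cycle_prod_def cycle_prod_except_def using assms by (intro prod.remove) auto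

lemma fps_deriv_prod:
  fixes h :: "'b \<Rightarrow> 'c :: comm_ring_1 fps"
  assumes "finite A"
  shows "fps_deriv (\<Prod>a\<in>A. h a) = (\<Sum>a\<in>A. fps_deriv (h a) * (\<Prod>b\<in>A - {a}. h b))"
  using assms
proof induction
  case (insert a A)
  have "(\<Prod>b\<in>insert a A - {c}. h b) = h a * (\<Prod>b\<in>A - {c}. h b)" if "c \<in> A" for c
  proof -
    have "insert a A - {c} = insert a (A - {c})" using insert.hyps that by auto
    then show ?thesis using insert.hyps by simp
  qed
  then have "(\<Sum>c\<in>A. fps_deriv (h c) * (\<Prod>b\<in>insert a A - {c}. h b))
      = h a * (\<Sum>c\<in>A. fps_deriv (h c) * (\<Prod>b\<in>A - {c}. h b))"
    by (simp add: sum_distrib_left mult.left_commute)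
  then show ?case using insert by simp
qed simp

lemma sum_orbits:
  fixes h :: "'a set \<Rightarrow> 'b :: comm_semiring_1"
  assumes "finite X" "f permutes X"
  shows "(\<Sum>x\<in>X. h (orbit f x)) = (\<Sum>c\<in>orbit f ` X. of_nat (card c) * h c)"
proof -
  have "(\<Sum>x\<in>X. h (orbit f x)) = (\<Sum>c\<in>orbit f ` X. \<Sum>z\<in>{z \<in> X. orbit f z = c}. h (orbit f z))"
    using assms(1) by (rule sum.image_gen)
  also have "\<dots> = (\<Sum>c\<in>orbit f ` X. of_nat (card c) * h c)"
    using fibre_orbit[OF assms] by (intro sum.cong) auto
  finally show ?thesis .
qed

text \<open>By the Leibniz rule each cycle contributes its length as a factor. Summing over points
  instead of cycles absorbs this factor.\<close>

lemma deriv_cycle_prod: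
  assumes "finite X" "f permutes X"
  shows "2 * fps_deriv (cycle_prod X f)
    = (\<Sum>x\<in>X. two_cosh (card (orbit f x)) * cycle_prod_except X f x)"
proof -
  have "2 * fps_deriv (cycle_prod X f) = (\<Sum>c\<in>orbit f ` X. of_nat (card c) *
      (two_cosh (card c) * (\<Prod>d\<in>orbit f ` X - {c}. two_sinh (card d))))"
    unfolding cycle_prod_def using assms(1)
    by (simp add: fps_deriv_prod sum_distrib_left mult.assoc[symmetric] deriv_two_sinh)
  then show ?thesis
    unfolding cycle_prod_except_def
    by (simp only: sum_orbits[OF assms, of "\<lambda>c. two_cosh (card c) *
        (\<Prod>d\<in>orbit f ` X - {c}. two_sinh (card d))"])
qed

section \<open>The cycle product and its derivative\<close>

text \<open>The product runs over a set of orbits, so the two arcs have to be distinct and must not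
  occur among the other cycles. Both follow from disjointness and nonemptiness.\<close>

lemma cycle_prod_cut:
  assumes X: "finite X" "f permutes X" "x \<in> X" and l: "0 < l" "l < card (orbit f x)"
  shows "cycle_prod X (transpose x ((f ^^ l) x) \<circ> f) =
    two_sinh l * two_sinh (card (orbit f x) - l) * cycle_prod_except X f x"
proof -
  have f: "permutation f" using X(1,2) by (rule permutes_imp_permutation)
  let ?A = "(\<lambda>n. (f ^^ n) x) ` {..<l}" and ?B = "(\<lambda>n. (f ^^ n) x) ` {l..<card (orbit f x)}"
  have inj: "inj_on (\<lambda>n. (f ^^ n) x) {..<card (orbit f x)}"
    and im: "(\<lambda>n. (f ^^ n) x) ` {..<card (orbit f x)} = orbit f x"
    using orbit_bij_betw(1)[OF f, of x] by (auto simp: bij_betw_def)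
  have card: "card ?A = l" "card ?B = card (orbit f x) - l"
    using l by (subst card_image; force intro: inj_on_subset[OF inj])+
  have "?A \<inter> ?B = (\<lambda>n. (f ^^ n) x) ` ({..<l} \<inter> {l..<card (orbit f x)})"
    using l by (intro inj_on_image_Int[OF inj, symmetric]) auto
  then have disj: "?A \<inter> ?B = {}" by auto
  have sub: "?A \<subseteq> orbit f x" "?B \<subseteq> orbit f x" using l im by auto
  have nonempty: "?A \<noteq> {}" "?B \<noteq> {}" using l by auto
  have "c \<inter> orbit f x = {}" if "c \<in> orbit f ` X - {orbit f x}" for c
    using that orbit_disjoint[OF f] by auto
  then have notin: "?A \<notin> orbit f ` X - {orbit f x}" "?B \<notin> orbit f ` X - {orbit f x}"
    using sub nonempty by blast+
  have "?A \<noteq> ?B" using disj nonempty by blast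
  then show ?thesis
    unfolding cycle_prod_def cycle_prod_except_def orbits_comp_transpose_cut[OF assms]
    using X(1) notin by (simp add: card mult.assoc)
qed

text \<open>The addition theorem splits the factor of the joined cycle so that each summand refers
  to the cycle of x alone or of y alone. Summation over y then becomes possible.\<close>

lemma cycle_prod_join:
  assumes X: "finite X" "f permutes X" "x \<in> X" "y \<in> X" and y: "y \<notin> orbit f x"
  shows "2 * cycle_prod X (transpose x y \<circ> f) =
    two_cosh (card (orbit f x)) * cycle_prod_except X f x +
    two_cosh (card (orbit f y)) * cycle_prod_except X f y"
proof -
  have f: "permutation f" using X(1,2) by (rule permutes_imp_permutation)
  let ?R = "\<Prod>c\<in>orbit f ` X - {orbit f x, orbit f y}. two_sinh (card c)"
  have ne: "orbit f x \<noteq> orbit f y" using y by (metis orbit_eq_iff_mem[OF f])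
  have disj: "orbit f x \<inter> orbit f y = {}" using ne by (rule orbit_disjoint[OF f])
  have fin: "finite (orbit f z)" for z
    using f by (simp add: finite_orbit permutation_self_in_orbit)
  have "c \<inter> orbit f x = {}" if "c \<in> orbit f ` X - {orbit f x, orbit f y}" for c
    using that orbit_disjoint[OF f] by auto
  then have "orbit f x \<union> orbit f y \<notin> orbit f ` X - {orbit f x, orbit f y}"
    using orbit_nonempty[of f x] by blast
  then have "cycle_prod X (transpose x y \<circ> f)
      = two_sinh (card (orbit f x) + card (orbit f y)) * ?R"
    unfolding cycle_prod_def orbits_comp_transpose_join[OF assms]
    using X(1) fin disj by (simp add: card_Un_disjoint)
  moreover have "cycle_prod_except X f x = two_sinh (card (orbit f y)) * ?R"
  proof -
    have "orbit f ` X - {orbit f x} - {orbit f y} = orbit f ` X - {orbit f x, orbit f y}" by auto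
    then show ?thesis
      using X ne prod.remove[of "orbit f ` X - {orbit f x}" "orbit f y" "\<lambda>c. two_sinh (card c)"]
      by (simp add: cycle_prod_except_def)
  qed
  moreover have "cycle_prod_except X f y = two_sinh (card (orbit f x)) * ?R"
  proof -
    have "orbit f ` X - {orbit f y} - {orbit f x} = orbit f ` X - {orbit f x, orbit f y}" by auto
    then show ?thesis
      using X ne prod.remove[of "orbit f ` X - {orbit f y}" "orbit f x" "\<lambda>c. two_sinh (card c)"]
      by (simp add: cycle_prod_except_def)
  qed
  moreover have "2 * (two_sinh (card (orbit f x) + card (orbit f y)) * ?R)
      = (2 * two_sinh (card (orbit f x) + card (orbit f y))) * ?R" by (simp only: mult.assoc)
  ultimately show ?thesis by (simp only: two_sinh_add) (simp add: algebra_simps)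
qed

text \<open>Points y on the cycle of x cut it and give the convolution of sines. The other points
  join two cycles; their terms are those of the derivative formula outside the cycle of x.\<close>

lemma sum_cycle_prod_transpose:
  assumes X: "finite X" "f permutes X" "x \<in> X"
  shows "2 * two_sinh 1 * (\<Sum>y\<in>X - {x}. cycle_prod X (transpose x y \<circ> f)) =
    2 * two_sinh 1 * fps_deriv (cycle_prod X f)
    + of_nat (card X) * two_sinh 1 * two_cosh (card (orbit f x)) * cycle_prod_except X f x
    - 2 * two_cosh 1 * cycle_prod X f"
proof -
  have f: "permutation f" using X(1,2) by (rule permutes_imp_permutation)
  define k where "k = card (orbit f x)"
  define R where "R = cycle_prod_except X f x"
  have k: "k > 0" unfolding k_def using f by (rule orbit_bij_betw)
  have sub: "orbit f x \<subseteq> X" using permutes_orbit_subset[OF X(2,3)] .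
  have self: "x \<in> orbit f x" using f by (rule permutation_self_in_orbit)
  \<comment> \<open>Exponent 0 is dropped because it gives y = x.\<close>
  have "bij_betw (\<lambda>n. (f ^^ n) x) ({..<k} - {0}) (orbit f x - {x})"
    using bij_betw_DiffI[OF orbit_bij_betw(1)[OF f, of x], of "{0}" "{x}"] k
    by (simp add: k_def self)
  moreover have "{..<k} - {0} = {1..<k}" by auto
  ultimately have bij: "bij_betw (\<lambda>n. (f ^^ n) x) {1..<k} (orbit f x - {x})" by simp
  have "(\<Sum>y\<in>orbit f x - {x}. cycle_prod X (transpose x y \<circ> f))
      = (\<Sum>l\<in>{1..<k}. cycle_prod X (transpose x ((f ^^ l) x) \<circ> f))"
    by (rule sum.reindex_bij_betw[OF bij, of "\<lambda>y. cycle_prod X (transpose x y \<circ> f)", symmetric])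
  also have "\<dots> = (\<Sum>l\<in>{1..<k}. two_sinh l * two_sinh (k - l)) * R"
    unfolding sum_distrib_right R_def k_def
    by (intro sum.cong) (auto intro: cycle_prod_cut[OF X])
  finally have cut: "two_sinh 1 * (\<Sum>y\<in>orbit f x - {x}. cycle_prod X (transpose x y \<circ> f))
      = of_nat k * two_sinh 1 * two_cosh k * R - two_cosh 1 * cycle_prod X f"
    using cycle_prod_split[OF X(1,3), of f] two_sinh_convolution[OF k]
    by (simp only: k_def[symmetric] R_def[symmetric] mult.assoc[symmetric])
      (simp add: algebra_simps)
  have "2 * (\<Sum>y\<in>X - orbit f x. cycle_prod X (transpose x y \<circ> f))
      = (\<Sum>y\<in>X - orbit f x. two_cosh k * R +
          two_cosh (card (orbit f y)) * cycle_prod_except X f y)"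
    unfolding sum_distrib_left R_def k_def
    by (intro sum.cong refl cycle_prod_join[OF X]) auto
  also have "\<dots> = of_nat (card X - k) * (two_cosh k * R)
      + (\<Sum>y\<in>X - orbit f x. two_cosh (card (orbit f y)) * cycle_prod_except X f y)"
    using sub X(1) by (simp add: sum.distrib card_Diff_subset finite_subset k_def)
  \<comment> \<open>The derivative formula sums over all of \<open>X\<close>; the terms on the cycle
    of x are subtracted and are all equal.\<close>
  also have "(\<Sum>y\<in>X - orbit f x. two_cosh (card (orbit f y)) * cycle_prod_except X f y)
      = 2 * fps_deriv (cycle_prod X f)
        - (\<Sum>y\<in>orbit f x. two_cosh (card (orbit f y)) * cycle_prod_except X f y)"
    using sub X by (simp add: deriv_cycle_prod sum_diff)
  also have "(\<Sum>y\<in>orbit f x. two_cosh (card (orbit f y)) * cycle_prod_except X f y)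
      = (\<Sum>y\<in>orbit f x. two_cosh k * R)"
  proof (intro sum.cong refl)
    fix y assume "y \<in> orbit f x"
    then have "orbit f y = orbit f x" by (simp only: orbit_eq_iff_mem[OF f])
    then show "two_cosh (card (orbit f y)) * cycle_prod_except X f y = two_cosh k * R"
      by (simp add: k_def R_def cycle_prod_except_def)
  qed
  finally have join: "2 * (\<Sum>y\<in>X - orbit f x. cycle_prod X (transpose x y \<circ> f))
      = (of_nat (card X) - 2 * of_nat k) * (two_cosh k * R) + 2 * fps_deriv (cycle_prod X f)"
    using sub X(1) by (simp add: k_def card_mono of_nat_diff o_def algebra_simps)
  have "X - {x} = (orbit f x - {x}) \<union> (X - orbit f x)" using sub self by auto
  then have "(\<Sum>y\<in>X - {x}. cycle_prod X (transpose x y \<circ> f))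
      = (\<Sum>y\<in>orbit f x - {x}. cycle_prod X (transpose x y \<circ> f))
        + (\<Sum>y\<in>X - orbit f x. cycle_prod X (transpose x y \<circ> f))"
    using X(1) sub by (simp add: sum.union_disjoint Int_Diff finite_subset disjoint_iff o_def)
  then have "2 * two_sinh 1 * (\<Sum>y\<in>X - {x}. cycle_prod X (transpose x y \<circ> f))
      = 2 * (two_sinh 1 * (\<Sum>y\<in>orbit f x - {x}. cycle_prod X (transpose x y \<circ> f)))
        + two_sinh 1 * (2 * (\<Sum>y\<in>X - orbit f x. cycle_prod X (transpose x y \<circ> f)))"
    by (simp only: algebra_simps)
  \<comment> \<open>The cut contributes 2 k and the join - 2 k times the same term, so only the
    multiple by \<open>card X\<close> survives.\<close>
  also have "\<dots> = 2 * (of_nat k * two_sinh 1 * two_cosh k * R - two_cosh 1 * cycle_prod X f)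
      + two_sinh 1 * ((of_nat (card X) - 2 * of_nat k) * (two_cosh k * R)
          + 2 * fps_deriv (cycle_prod X f))"
    by (simp only: cut join)
  finally show ?thesis by (simp only: k_def[symmetric] R_def[symmetric]) (simp add: algebra_simps)
qed

text \<open>The division is exact on nonempty sets, as \<open>two_sinh 1\<close> divides every \<open>two_sinh k\<close>.\<close>

definition cycle_ratio :: "'a set \<Rightarrow> ('a \<Rightarrow> 'a) \<Rightarrow> real fps"
  where "cycle_ratio X f = cycle_prod X f div two_sinh 1"

lemma cycle_ratio_split:
  assumes "finite X" "x \<in> X"
  shows "cycle_ratio X f = sinh_ratio (card (orbit f x)) * cycle_prod_except X f x"
proof -
  have "cycle_prod X f = two_sinh 1 * (sinh_ratio (card (orbit f x)) * cycle_prod_except X f x)"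
    using cycle_prod_split[OF assms, of f] two_sinh_eq_ratio[of "card (orbit f x)"]
    by (simp add: mult.assoc)
  then show ?thesis
    unfolding cycle_ratio_def by (simp add: two_sinh_nz)
qed

lemma two_sinh_mult_cycle_ratio:
  assumes "finite X" "x \<in> X"
  shows "two_sinh 1 * cycle_ratio X f = cycle_prod X f"
  using cycle_ratio_split[OF assms, of f] cycle_prod_split[OF assms, of f]
    two_sinh_eq_ratio[of "card (orbit f x)"]
  by (simp add: mult.assoc)

text \<open>Differentiation of \<open>two_sinh 1 * cycle_ratio X f = cycle_prod X f\<close>, with
  half of \<open>two_cosh 1\<close> as the derivative of \<open>two_sinh 1\<close>.\<close>

lemma deriv_cycle_ratio:
  assumes "finite X" "x \<in> X"
  shows "2 * two_sinh 1 * fps_deriv (cycle_ratio X f)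
    = 2 * fps_deriv (cycle_prod X f) - two_cosh 1 * cycle_ratio X f"
proof -
  have "2 * fps_deriv (cycle_prod X f)
      = two_sinh 1 * (2 * fps_deriv (cycle_ratio X f)) + 2 * fps_deriv (two_sinh 1) * cycle_ratio X f"
    unfolding two_sinh_mult_cycle_ratio[OF assms, of f, symmetric] fps_deriv_mult
    by (simp add: algebra_simps)
  then show ?thesis by (simp add: deriv_two_sinh algebra_simps)
qed

lemma permutes_comp_transpose:
  assumes "f permutes X" "x \<in> X" "y \<in> X"
  shows "transpose x y \<circ> f permutes X"
  using assms by (simp add: permutes_compose permutes_swap_id)

lemma cycle_prod_remove_fixpoint:
  assumes "permutation g" "finite X" "q \<in> X" "g q = q"
  shows "cycle_prod X g = two_sinh 1 * cycle_prod (X - {q}) g"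
proof -
  have q: "orbit g q = {q}" using assms(4) by (simp add: orbit_eq_singleton_iff)
  have "orbit g ` (X - {q}) = orbit g ` X - {{q}}"
    using orbit_image_outside[OF assms(1), of X q] by (simp add: q)
  then have "cycle_prod (X - {q}) g = cycle_prod_except X g q"
    by (simp add: cycle_prod_def cycle_prod_except_def q)
  then show ?thesis
    using cycle_prod_split[OF assms(2,3), of g] by (simp add: q)
qed

text \<open>
  Only the predecessor of \<open>p\<close> on its cycle contributes. If \<open>p\<close> is a fixed point, both sides
  vanish because \<open>two_sinh 0 = 0\<close>.
\<close>

lemma sum_cycle_prod_predecessor:
  assumes X: "finite X" "f permutes X" "p \<in> X"
  shows "(\<Sum>i\<in>X - {p}. if f i = p then cycle_prod (X - {i}) (transpose p i \<circ> f) else 0)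
    = two_sinh (card (orbit f p) - 1) * cycle_prod_except X f p"
proof -
  have f: "permutation f" using X(1,2) by (rule permutes_imp_permutation)
  \<comment> \<open>The predecessor of \<open>p\<close> on its cycle.\<close>
  define q where "q = (f ^^ (card (orbit f p) - 1)) p"
  have "f q = (f ^^ card (orbit f p)) p"
    using orbit_bij_betw(3)[OF f, of p] by (cases "card (orbit f p)") (auto simp: q_def)
  then have q: "f q = p" using orbit_bij_betw(2)[OF f, of p] by simp
  have uniq: "f i = p \<longleftrightarrow> i = q" for i
    using q permutes_inj[OF X(2)] by (auto dest: injD)
  have "q \<in> X" using q X(2,3) by (metis permutes_in_image)
  show ?thesis
  proof (cases "q = p")
    case True
    then have "orbit f p = {p}" using q by (simp add: orbit_eq_singleton_iff)
    moreover have "(\<Sum>i\<in>X - {p}. if f i = p then cycle_prod (X - {i}) (transpose p i \<circ> f) else 0) = 0"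
      using uniq True by (intro sum.neutral) auto
    ultimately show ?thesis by simp
  next
    case False
    then have "card (orbit f p) \<noteq> 1" by (auto simp: q_def)
    with orbit_bij_betw(3)[OF f, of p] have k: "card (orbit f p) \<ge> 2" by linarith
    have "permutation (transpose p q \<circ> f)"
      using f by (simp add: permutation_compose permutation_swap_id)
    then have "two_sinh 1 * cycle_prod (X - {q}) (transpose p q \<circ> f)
        = cycle_prod X (transpose p q \<circ> f)"
      using X(1) \<open>q \<in> X\<close> q by (intro cycle_prod_remove_fixpoint[symmetric]) auto
    \<comment> \<open>Cutting at the last position splits off \<open>q\<close> as a fixed point; its
      factor \<open>two_sinh 1\<close> cancels below.\<close>
    also have "\<dots> = two_sinh (card (orbit f p) - 1) *
        two_sinh (card (orbit f p) - (card (orbit f p) - 1)) * cycle_prod_except X f p"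
      unfolding q_def using k by (intro cycle_prod_cut[OF X]) auto
    also have "card (orbit f p) - (card (orbit f p) - 1) = 1" using k by simp
    finally have "two_sinh 1 * cycle_prod (X - {q}) (transpose p q \<circ> f) =
        two_sinh 1 * (two_sinh (card (orbit f p) - 1) * cycle_prod_except X f p)"
      by (simp only: mult.assoc mult.left_commute)
    then have "cycle_prod (X - {q}) (transpose p q \<circ> f) =
        two_sinh (card (orbit f p) - 1) * cycle_prod_except X f p"
      by (simp add: two_sinh_nz)
    then show ?thesis using False \<open>q \<in> X\<close> X(1) by (simp add: uniq)
  qed
qed

section \<open>The two differential equations\<close>

text \<open>The summand for i belongs to words with first letter i. Its first part covers words in
  which i recurs. Its second part covers those in which it does not: the remaining product fixes i,
  which forces \<open>f i = p\<close>. The factor \<open>card X\<close> compensates for the smaller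
  factorial on \<open>X - {i}\<close>.\<close>

lemma deriv_star_series:
  assumes X: "finite X" "f permutes X" "p \<in> X" and n: "card X = Suc (Suc m)"
  shows "fps_deriv (two_sinh 1 ^ Suc m * cycle_ratio X f) =
    (\<Sum>i\<in>X - {p}. two_sinh 1 ^ Suc m * cycle_ratio X (transpose p i \<circ> f)
      + of_nat (card X) * (if f i = p
          then two_sinh 1 ^ m * cycle_ratio (X - {i}) (transpose p i \<circ> f) else 0))"
    (is "?lhs = ?rhs")
proof -
  let ?S = "two_sinh 1" and ?C = "two_cosh 1"
  define G where "G = cycle_ratio X f"
  define P where "P = cycle_prod X f"
  define D where "D = fps_deriv P"
  define k where "k = card (orbit f p)"
  define R where "R = cycle_prod_except X f p"
  have f: "permutation f" using X(1,2) by (rule permutes_imp_permutation)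
  have SG: "?S * G = P"
    unfolding G_def P_def using X(1,3) by (rule two_sinh_mult_cycle_ratio)
  have P: "P = two_sinh k * R"
    unfolding P_def k_def R_def using X(1,3) by (rule cycle_prod_split)
  have DG: "2 * ?S * fps_deriv G = 2 * D - ?C * G"
    unfolding G_def D_def P_def using X(1,3) by (rule deriv_cycle_ratio)
  have DS: "2 * fps_deriv ?S = ?C" using deriv_two_sinh[of 1] by simp
  have k: "k > 0" unfolding k_def using f by (rule orbit_bij_betw)
  have "fps_deriv (?S ^ Suc m * G) = of_nat (Suc m) * fps_deriv ?S * ?S ^ m * G + ?S ^ Suc m * fps_deriv G"
    by (simp add: fps_deriv_power' del: power_Suc)
  then have "2 * ?S * fps_deriv (?S ^ Suc m * G)
      = of_nat (Suc m) * ?S ^ m * (2 * fps_deriv ?S) * (?S * G) + ?S ^ Suc m * (2 * ?S * fps_deriv G)"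
    by (simp only: algebra_simps)
  also have "\<dots> = of_nat (Suc m) * ?S ^ m * ?C * P + ?S ^ Suc m * (2 * D) - ?S ^ m * ?C * (?S * G)"
    by (simp only: DS SG DG) (simp add: algebra_simps flip: SG)
  also have "\<dots> = ?S ^ m * (2 * ?S * D + of_nat m * ?C * P)"
    by (simp only: SG) (simp add: algebra_simps)
  finally have lhs: "2 * ?S * ?lhs = ?S ^ m * (2 * ?S * D + of_nat m * ?C * P)"
    by (simp only: G_def)

  have "?S * ?rhs = (\<Sum>i\<in>X - {p}. ?S ^ Suc m * (?S * cycle_ratio X (transpose p i \<circ> f))
      + of_nat (card X) * ?S ^ m * (if f i = p
          then ?S * cycle_ratio (X - {i}) (transpose p i \<circ> f) else 0))"
    unfolding sum_distrib_left by (intro sum.cong) (auto simp: algebra_simps)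
  also have "\<dots> = (\<Sum>i\<in>X - {p}. ?S ^ Suc m * cycle_prod X (transpose p i \<circ> f)
      + of_nat (card X) * ?S ^ m * (if f i = p
          then cycle_prod (X - {i}) (transpose p i \<circ> f) else 0))"
  proof (intro sum.cong refl)
    fix i assume "i \<in> X - {p}"
    then have "?S * cycle_ratio (X - {i}) (transpose p i \<circ> f) = cycle_prod (X - {i}) (transpose p i \<circ> f)"
      using X by (intro two_sinh_mult_cycle_ratio[of _ p]) auto
    moreover have "?S * cycle_ratio X (transpose p i \<circ> f) = cycle_prod X (transpose p i \<circ> f)"
      using X by (intro two_sinh_mult_cycle_ratio[of _ p]) auto
    ultimately show "?S ^ Suc m * (?S * cycle_ratio X (transpose p i \<circ> f))
      + of_nat (card X) * ?S ^ m * (if f i = p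
          then ?S * cycle_ratio (X - {i}) (transpose p i \<circ> f) else 0) =
      ?S ^ Suc m * cycle_prod X (transpose p i \<circ> f)
      + of_nat (card X) * ?S ^ m * (if f i = p
          then cycle_prod (X - {i}) (transpose p i \<circ> f) else 0)" by simp
  qed
  also have "\<dots> = ?S ^ Suc m * (\<Sum>i\<in>X - {p}. cycle_prod X (transpose p i \<circ> f))
      + of_nat (card X) * ?S ^ m * (two_sinh (k - 1) * R)"
    by (simp only: sum.distrib sum_distrib_left[symmetric] sum_cycle_prod_predecessor[OF X]
        k_def R_def)
  finally have "2 * (?S * ?rhs) = ?S ^ m * (2 * ?S * (\<Sum>i\<in>X - {p}. cycle_prod X (transpose p i \<circ> f)))
      + of_nat (card X) * ?S ^ m * (2 * two_sinh (k - 1) * R)"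
    by (simp add: algebra_simps)
  also have "2 * two_sinh (k - 1) = two_sinh k * ?C - two_cosh k * ?S"
    using two_sinh_Suc_diff[of "k - 1"] k by simp
  also have "2 * ?S * (\<Sum>i\<in>X - {p}. cycle_prod X (transpose p i \<circ> f))
      = 2 * ?S * D + of_nat (card X) * ?S * two_cosh k * R - 2 * ?C * P"
    unfolding D_def P_def R_def k_def by (rule sum_cycle_prod_transpose[OF X])
  \<comment> \<open>The terms with \<open>two_cosh k\<close> cancel, and
    \<open>two_cosh 1 * P\<close> keeps the coefficient \<open>card X - 2\<close>, which is
    m.\<close>
  also have "?S ^ m * (2 * ?S * D + of_nat (card X) * ?S * two_cosh k * R - 2 * ?C * P)
      + of_nat (card X) * ?S ^ m * ((two_sinh k * ?C - two_cosh k * ?S) * R)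
      = ?S ^ m * (2 * ?S * D + of_nat m * ?C * P)"
    unfolding n P by (simp add: algebra_simps)
  finally have "2 * (?S * ?rhs) = ?S ^ m * (2 * ?S * D + of_nat m * ?C * P)" .
  with lhs have "2 * ?S * ?lhs = 2 * ?S * ?rhs" by (simp only: mult.assoc)
  then show ?thesis by (simp add: two_sinh_nz del: power_Suc)
qed

text \<open>The formula for transpositions moving x is summed over x, where the terms of the
  individual cycles add up to the derivative once more. Ordered pairs meet each transposition twice,
  hence the factor 2.\<close>

lemma deriv_cycle_series:
  assumes X: "finite X" "f permutes X"
  shows "2 * of_nat (card X) * fps_deriv (cycle_ratio X f)
    = (\<Sum>x\<in>X. \<Sum>y\<in>X - {x}. cycle_ratio X (transpose x y \<circ> f))"
proof (cases "X = {}")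
  case False
  let ?S = "two_sinh 1" and ?C = "two_cosh 1"
  define P where "P = cycle_prod X f"
  define D where "D = fps_deriv P"
  obtain z where z: "z \<in> X" using False by blast
  have "?S * (\<Sum>x\<in>X. \<Sum>y\<in>X - {x}. cycle_ratio X (transpose x y \<circ> f))
      = (\<Sum>x\<in>X. \<Sum>y\<in>X - {x}. cycle_prod X (transpose x y \<circ> f))"
    unfolding sum_distrib_left by (intro sum.cong refl two_sinh_mult_cycle_ratio[OF X(1) z])
  then have "2 * ?S * (?S * (\<Sum>x\<in>X. \<Sum>y\<in>X - {x}. cycle_ratio X (transpose x y \<circ> f)))
      = (\<Sum>x\<in>X. 2 * ?S * (\<Sum>y\<in>X - {x}. cycle_prod X (transpose x y \<circ> f)))"
    by (simp only: sum_distrib_left)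
  also have "\<dots> = (\<Sum>x\<in>X. (2 * ?S * D - 2 * ?C * P)
      + of_nat (card X) * ?S * (two_cosh (card (orbit f x)) * cycle_prod_except X f x))"
    by (intro sum.cong refl)
      (simp only: sum_cycle_prod_transpose[OF X] D_def P_def, simp add: algebra_simps)
  also have "\<dots> = of_nat (card X) * (2 * ?S * D - 2 * ?C * P) + of_nat (card X) * ?S * (2 * D)"
    by (simp add: sum.distrib sum_distrib_left[symmetric] deriv_cycle_prod[OF X, symmetric]
        D_def P_def)
  also have "\<dots> = of_nat (card X) * 2 * ?S * (2 * D) - of_nat (card X) * 2 * ?C * P"
    by (simp add: algebra_simps)
  also have "\<dots> = 2 * of_nat (card X) * ?S * (2 * ?S * fps_deriv (cycle_ratio X f))"
    unfolding deriv_cycle_ratio[OF X(1) z]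
    by (simp add: D_def P_def algebra_simps flip: two_sinh_mult_cycle_ratio[OF X(1) z])
  finally have eq: "(2 * ?S * ?S) * (\<Sum>x\<in>X. \<Sum>y\<in>X - {x}. cycle_ratio X (transpose x y \<circ> f))
      = (2 * ?S * ?S) * (2 * of_nat (card X) * fps_deriv (cycle_ratio X f))"
    by (simp only: mult_ac)
  have "2 * ?S * ?S \<noteq> 0" by (simp add: two_sinh_nz)
  from mult_left_cancel[OF this, THEN iffD1, OF eq] show ?thesis by (rule sym)
qed simp

section \<open>Factorizations as words\<close>

lemma perm_product_Nil [simp]: "perm_product [] = id"
  by (simp add: perm_product_def)

lemma perm_product_Cons [simp]: "perm_product (t # ts) = t \<circ> perm_product ts"
  by (simp add: perm_product_def)

lemma transpose_comp_eq_iff: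
  fixes f g :: "'b \<Rightarrow> 'a"
  shows "transpose a b \<circ> f = g \<longleftrightarrow> f = transpose a b \<circ> g"
proof -
  have "transpose a b \<circ> (transpose a b \<circ> h) = h" for h :: "'b \<Rightarrow> 'a"
    by (simp add: fun_eq_iff)
  then show ?thesis by metis
qed

lemma transpositions_comp_eq_iff: "t \<in> transpositions N \<Longrightarrow> t \<circ> f = g \<longleftrightarrow> f = t \<circ> g"
  unfolding transpositions_def by (elim CollectE exE conjE, hypsubst, rule transpose_comp_eq_iff)

text \<open>
  A star factorization is transitive exactly if every non-pivot occurs in it, hence the condition
  \<open>set xs = T\<close>.
\<close>

definition star_words :: "nat \<Rightarrow> nat \<Rightarrow> nat set \<Rightarrow> (nat \<Rightarrow> nat) \<Rightarrow> nat list set"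
  where "star_words p r T f =
    {xs. length xs = r \<and> set xs = T \<and> perm_product (map (transpose p) xs) = f}"

lemma finite_star_words: "finite T \<Longrightarrow> finite (star_words p r T f)"
  by (rule finite_subset[OF _ finite_lists_length_eq[of T r]]) (auto simp: star_words_def)

lemma star_words_0: "star_words p 0 T f = (if T = {} \<and> f = id then {[]} else {})"
  by (auto simp: star_words_def)

lemma star_words_fixpoint:
  assumes "xs \<in> star_words p r T f" "i \<notin> T" "i \<noteq> p"
  shows "f i = i"
proof -
  have "i \<notin> set xs \<Longrightarrow> perm_product (map (transpose p) xs) i = i"
    using assms(3) by (induction xs) (auto simp: transpose_def)
  then show ?thesis using assms(1,2) by (auto simp: star_words_def)
qed

text \<open>After the first letter i is removed, the remaining letters form \<open>T\<close> if i
  recurs and \<open>T - {i}\<close> otherwise.\<close>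

lemma star_words_Suc:
  "star_words p (Suc r) T f = (\<Union>i\<in>T. (#) i `
    (star_words p r T (transpose p i \<circ> f) \<union> star_words p r (T - {i}) (transpose p i \<circ> f)))"
    (is "?L = ?R")
proof (intro equalityI subsetI)
  fix xs assume xs: "xs \<in> ?L"
  then obtain i ys where [simp]: "xs = i # ys" by (auto simp: star_words_def length_Suc_conv)
  have "set ys = T \<or> set ys = T - {i}" "i \<in> T"
    using xs by (auto simp: star_words_def)
  then show "xs \<in> ?R"
    using xs by (auto simp: star_words_def transpose_comp_eq_iff)
next
  fix xs assume "xs \<in> ?R"
  then obtain i ys where xs: "xs = i # ys" and i: "i \<in> T"
    and ys: "ys \<in> star_words p r T (transpose p i \<circ> f) \<union> star_words p r (T - {i}) (transpose p i \<circ> f)"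
    by blast
  from ys have prod: "perm_product (map (transpose p) ys) = transpose p i \<circ> f"
    and len: "length ys = r" and set: "set ys = T \<or> set ys = T - {i}"
    unfolding star_words_def by blast+
  have "perm_product (map (transpose p) xs) = f"
    unfolding xs list.map perm_product_Cons transpose_comp_eq_iff by (rule prod)
  moreover have "length xs = Suc r" by (simp add: xs len)
  moreover have "set xs = T" using set i by (auto simp: xs)
  ultimately show "xs \<in> ?L" unfolding star_words_def by blast
qed

lemma card_star_words_Suc:
  assumes "finite T"
  shows "card (star_words p (Suc r) T f) =
    (\<Sum>i\<in>T. card (star_words p r T (transpose p i \<circ> f))
      + card (star_words p r (T - {i}) (transpose p i \<circ> f)))"
proof -
  have "card (star_words p (Suc r) T f) = (\<Sum>i\<in>T. card ((#) i `
    (star_words p r T (transpose p i \<circ> f) \<union> star_words p r (T - {i}) (transpose p i \<circ> f))))"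
    unfolding star_words_Suc using assms by (subst card_UN_disjoint) (auto simp: finite_star_words)
  also have "\<dots> = (\<Sum>i\<in>T. card (star_words p r T (transpose p i \<circ> f))
      + card (star_words p r (T - {i}) (transpose p i \<circ> f)))"
  proof (intro sum.cong refl)
    fix i assume "i \<in> T"
    then have "star_words p r T (transpose p i \<circ> f) \<inter> star_words p r (T - {i}) (transpose p i \<circ> f) = {}"
      by (auto simp: star_words_def)
    then show "card ((#) i ` (star_words p r T (transpose p i \<circ> f) \<union> star_words p r (T - {i}) (transpose p i \<circ> f)))
      = card (star_words p r T (transpose p i \<circ> f)) + card (star_words p r (T - {i}) (transpose p i \<circ> f))"
      using assms by (subst card_image) (auto simp: card_Un_disjoint finite_star_words)
  qed
  finally show ?thesis .
qed

section \<open>Factorizations with a full cycle\<close>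

text \<open>Here the number of transpositions is a free parameter, as induction on it requires; in
  \<open>cycle_factorizations\<close> it is tied to the cycle type and the genus.\<close>

definition cycle_words :: "nat \<Rightarrow> nat \<Rightarrow> (nat \<Rightarrow> nat) \<Rightarrow> ((nat \<Rightarrow> nat) list \<times> (nat \<Rightarrow> nat)) set"
  where "cycle_words N s f = {(ts, c). length ts = s \<and> set ts \<subseteq> transpositions N \<and>
    c \<in> conj_class N {#N#} \<and> perm_product ts \<circ> c = f}"

lemma finite_transpositions: "finite (transpositions N)"
proof -
  have "transpositions N \<subseteq> (\<lambda>(i, j). transpose i j) ` ({1..N} \<times> {1..N})"
    by (auto simp: transpositions_def)
  then show ?thesis by (rule finite_subset) simp
qed

lemma finite_cycle_words: "finite (cycle_words N s f)"
proof -
  have "finite {p :: nat \<Rightarrow> nat. p permutes {1..N}}" by (rule finite_permutations) simp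
  then have "finite (conj_class N {#N#})"
    by (rule rev_finite_subset) (auto simp: conj_class_def sym_group_carrier)
  then have "finite ({ts. set ts \<subseteq> transpositions N \<and> length ts = s} \<times> conj_class N {#N#})"
    using finite_lists_length_eq[OF finite_transpositions] by blast
  then show ?thesis by (rule rev_finite_subset) (auto simp: cycle_words_def)
qed

lemma card_cycle_words_Suc:
  "card (cycle_words N (Suc s) f) = (\<Sum>t\<in>transpositions N. card (cycle_words N s (t \<circ> f)))"
proof -
  have "cycle_words N (Suc s) f
      = (\<Union>t\<in>transpositions N. map_prod ((#) t) id ` cycle_words N s (t \<circ> f))" (is "?L = ?R")
  proof (intro equalityI subsetI)
    fix z assume z: "z \<in> ?L"
    then obtain t ts c where [simp]: "z = (t # ts, c)"
      by (auto simp: cycle_words_def length_Suc_conv)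
    have t: "t \<in> transpositions N" using z by (auto simp: cycle_words_def)
    then have "(ts, c) \<in> cycle_words N s (t \<circ> f)"
      using z by (simp add: cycle_words_def comp_assoc transpositions_comp_eq_iff)
    then have "map_prod ((#) t) id (ts, c) \<in> map_prod ((#) t) id ` cycle_words N s (t \<circ> f)"
      by (rule imageI)
    then show "z \<in> ?R" using t by auto
  next
    fix z assume "z \<in> ?R"
    then obtain t ts c where "z = (t # ts, c)" "t \<in> transpositions N"
        "(ts, c) \<in> cycle_words N s (t \<circ> f)" by auto
    then show "z \<in> ?L"
      by (simp add: cycle_words_def comp_assoc transpositions_comp_eq_iff)
  qed
  then have "card (cycle_words N (Suc s) f)
      = (\<Sum>t\<in>transpositions N. card (map_prod ((#) t) id ` cycle_words N s (t \<circ> f)))"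
    by (simp add: card_UN_disjoint finite_transpositions finite_cycle_words) 
       (subst card_UN_disjoint, auto simp: finite_transpositions finite_cycle_words)
  moreover have "inj_on (map_prod ((#) t) id) A" for t :: "nat \<Rightarrow> nat" and A :: "(_ \<times> (nat \<Rightarrow> nat)) set"
    by (auto simp: inj_on_def)
  ultimately show ?thesis by (simp add: card_image)
qed

text \<open>Pairs with x < y represent every transposition exactly once; exchanging the entries
  gives the pairs with y < x.\<close>

lemma sum_transpositions:
  "2 * (\<Sum>t\<in>transpositions N. h t) = (\<Sum>x\<in>{1..N}. \<Sum>y\<in>{1..N} - {x}. h (transpose x y :: nat \<Rightarrow> nat))"
  for h :: "_ \<Rightarrow> real"
proof -
  let ?U = "{(x, y) \<in> {1..N} \<times> {1..N}. x < y}" and ?D = "{(x, y) \<in> {1..N} \<times> {1..N}. y < x}"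
  have fin: "finite ?U" "finite ?D" by (rule finite_subset[of _ "{1..N} \<times> {1..N}"]; auto)+
  have "inj_on (\<lambda>(x, y). transpose x y) ?U"
  proof (intro inj_onI, clarsimp)
    fix a b c d :: nat assume less: "a < b" "c < d" and eq: "transpose a b = transpose c d"
    have "transpose c d a = b" "transpose a b c = d" by (simp_all flip: eq) (simp add: eq)
    then show "a = c \<and> b = d" using less by (auto simp: transpose_def split: if_splits)
  qed
  moreover have "transpositions N = (\<lambda>(x, y). transpose x y) ` ?U"
  proof (intro equalityI subsetI)
    fix t assume "t \<in> transpositions N"
    then obtain i j where "t = transpose i j" "i \<in> {1..N}" "j \<in> {1..N}" "i \<noteq> j"
      by (auto simp: transpositions_def)
    then have mem: "(min i j, max i j) \<in> ?U" and t: "t = transpose (min i j) (max i j)"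
      by (auto simp: min_def max_def transpose_commute)
    from imageI[OF mem, of "\<lambda>(x, y). transpose x y"]
    show "t \<in> (\<lambda>(x, y). transpose x y) ` ?U" by (simp only: prod.case t)
  qed (auto simp: transpositions_def)
  ultimately have U: "(\<Sum>t\<in>transpositions N. h t) = (\<Sum>(x, y)\<in>?U. h (transpose x y))"
    by (simp add: sum.reindex case_prod_unfold)
  also have "\<dots> = (\<Sum>(x, y)\<in>?D. h (transpose x y))"
    by (rule sum.reindex_bij_witness[of _ prod.swap prod.swap]) (auto simp: transpose_commute)
  finally have "2 * (\<Sum>t\<in>transpositions N. h t)
      = (\<Sum>(x, y)\<in>?U. h (transpose x y)) + (\<Sum>(x, y)\<in>?D. h (transpose x y))" using U by simp
  also have "\<dots> = (\<Sum>(x, y)\<in>?U \<union> ?D. h (transpose x y))"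
    using fin by (intro sum.union_disjoint[symmetric]) auto
  also have "?U \<union> ?D = (SIGMA x:{1..N}. {1..N} - {x})" by auto
  also have "(\<Sum>(x, y)\<in>(SIGMA x:{1..N}. {1..N} - {x}). h (transpose x y))
      = (\<Sum>x\<in>{1..N}. \<Sum>y\<in>{1..N} - {x}. h (transpose x y))"
    by (intro sum.Sigma[symmetric]) auto
  finally show ?thesis .
qed

section \<open>Transitivity of star transpositions\<close>

text \<open>The stabilizer of a point is a subgroup.\<close>

lemma generate_fixes:
  assumes "A \<subseteq> carrier (sym_group n)" "\<And>f. f \<in> A \<Longrightarrow> f x = x" "g \<in> generate (sym_group n) A"
  shows "g x = x"
  using assms(3)
proof induction
  case one
  then show ?case by (simp add: sym_group_def)
next
  case (incl h)
  then show ?case by (rule assms(2))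
next
  case (inv h)
  then have "h permutes {1..n}" "h x = x" using assms by (auto simp: sym_group_carrier)
  then show ?case
    using assms(1) inv by (simp add: subset_iff permutes_inv_eq)
next
  case (eng h1 h2)
  then show ?case by (simp add: sym_group_def)
qed

text \<open>A missing letter is fixed by the whole group, so the pivot cannot be carried to it. If
  all letters are present, x is carried to y by way of the pivot; for x or y equal to n the
  transposition degenerates to the identity.\<close>

lemma transitive_star_iff:
  assumes T: "T \<subseteq> {1..n - 1}" and n: "n \<ge> 1"
  shows "acts_transitively n (generate (sym_group n) (transpose n ` T)) \<longleftrightarrow> T = {1..n - 1}"
proof
  assume trans: "acts_transitively n (generate (sym_group n) (transpose n ` T))"
  show "T = {1..n - 1}"
  proof (rule ccontr)
    assume "T \<noteq> {1..n - 1}"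
    then obtain i where i: "i \<in> {1..n - 1}" "i \<notin> T" using T by blast
    have "transpose n ` T \<subseteq> carrier (sym_group n)"
      using T n by (auto simp: sym_group_carrier subset_iff intro!: permutes_swap_id)
    moreover have "f i = i" if "f \<in> transpose n ` T" for f
      using that i n by (auto simp: transpose_def)
    ultimately have "g i = i" if "g \<in> generate (sym_group n) (transpose n ` T)" for g
      using generate_fixes that by blast
    moreover have "i \<in> {1..n}" "n \<in> {1..n}" "i \<noteq> n" using i n by auto
    ultimately show False using trans by (metis acts_transitively_def)
  qed
next
  assume T: "T = {1..n - 1}"
  let ?G = "generate (sym_group n) (transpose n ` T)"
  have id: "id \<in> ?G" using generate.one[of "sym_group n"] by (simp add: sym_group_one)
  have star: "transpose n x \<in> ?G" if "x \<in> {1..n}" for x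
  proof (cases "x = n")
    case False
    then have "x \<in> T" using that T by auto
    then show ?thesis by (intro generate.incl) auto
  qed (use id in simp)
  show "acts_transitively n ?G"
    unfolding acts_transitively_def
  proof (intro ballI)
    fix x y assume "x \<in> {1..n}" "y \<in> {1..n}"
    then have "transpose n y \<circ> transpose n x \<in> ?G"
      using generate.eng[OF star star] by (simp add: sym_group_mult)
    moreover have "(transpose n y \<circ> transpose n x) x = y" by simp
    ultimately show "\<exists>p\<in>?G. p x = y" by blast
  qed
qed

section \<open>Counts as coefficients\<close>

lemma fps_nth_of_nat_mult: "fps_nth (of_nat k * F) r = of_nat k * fps_nth F r"
  for F :: "'a :: comm_ring_1 fps"
  by (simp flip: fps_of_nat)

lemma cycle_ratio_singleton: "cycle_ratio {p} id = 1"
proof -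
  have "orbit id p = {p}" by (simp add: orbit_eq_singleton_iff)
  then show ?thesis
    using cycle_ratio_split[of "{p}" p id] by (simp add: cycle_prod_except_def sinh_ratio_def)
qed

text \<open>Induction on r: taking the next coefficient amounts to differentiating, and
  \<open>deriv_star_series\<close> matches the recursion on the first letter term by term. The
  letter set varies because a first letter that does not recur leaves it.\<close>

lemma card_star_words:
  assumes "finite T" "p \<notin> T" "f permutes insert p T"
  shows "fact (Suc (card T)) * real (card (star_words p r T f))
    = fact r * fps_nth (two_sinh 1 ^ card T * cycle_ratio (insert p T) f) r"
  using assms
proof (induction r arbitrary: T f)
  case (0 T f)
  show ?case
  proof (cases "T = {}")
    case True
    then have "f = id" using "0.prems" by simp
    then show ?thesis unfolding True \<open>f = id\<close> star_words_0 cycle_ratio_singleton by simp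
  next
    case False
    \<comment> \<open>A positive power of \<open>two_sinh 1\<close> has constant term 0, in accord
      with the absence of an empty word using all letters.\<close>
    then have "card T > 0" using "0.prems" by (simp add: card_gt_0_iff)
    then show ?thesis by (simp add: False star_words_0 fps_power_zeroth)
  qed
next
  case (Suc r T f)
  note prems = Suc.prems
  show ?case
  proof (cases "T = {}")
    case True
    then have "f = id" using prems by simp
    then show ?thesis unfolding True \<open>f = id\<close> star_words_Suc cycle_ratio_singleton by simp
  next
    case False
    then obtain m where m: "card T = Suc m" using prems by (cases "card T") auto
    let ?X = "insert p T" and ?S = "two_sinh 1"
    have X: "finite ?X" "p \<in> ?X" "?X - {p} = T" "card ?X = Suc (Suc m)"
      using prems m by auto
    have perm: "transpose p i \<circ> f permutes ?X" if "i \<in> T" for i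
      using prems that by (intro permutes_comp_transpose) auto
    have first: "fact r * fps_nth (?S ^ Suc m * cycle_ratio ?X (transpose p i \<circ> f)) r
        = fact (Suc (card T)) * real (card (star_words p r T (transpose p i \<circ> f)))"
      if "i \<in> T" for i
      using Suc.IH[OF prems(1,2) perm[OF that]] by (simp only: m)
    have last: "fact r * fps_nth (of_nat (card ?X) * (if f i = p
          then ?S ^ m * cycle_ratio (?X - {i}) (transpose p i \<circ> f) else 0)) r
        = fact (Suc (card T)) * real (card (star_words p r (T - {i}) (transpose p i \<circ> f)))"
      if i: "i \<in> T" for i
    \<comment> \<open>The remaining product fixes i exactly if \<open>f i = p\<close>. Otherwise no
      word without the letter i can represent it.\<close>
    proof (cases "f i = p")
      case True
      have ins: "?X - {i} = insert p (T - {i})" using i prems(2) by auto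
      have "transpose p i \<circ> f permutes insert p (T - {i})"
        unfolding ins[symmetric]
      proof (rule permutes_superset[OF perm[OF i]])
        show "\<And>x. x \<in> ?X - (?X - {i}) \<Longrightarrow> (transpose p i \<circ> f) x = x" using True by auto
      qed
      then have "fact (Suc (card (T - {i})))
            * real (card (star_words p r (T - {i}) (transpose p i \<circ> f)))
          = fact r * fps_nth (?S ^ card (T - {i}) * cycle_ratio (?X - {i}) (transpose p i \<circ> f)) r"
        unfolding ins using prems(1,2) by (intro Suc.IH) (assumption | simp)+
      moreover have "card (T - {i}) = m" using prems(1) i m by simp
      ultimately have IH: "fact (Suc m) * real (card (star_words p r (T - {i}) (transpose p i \<circ> f)))
          = fact r * fps_nth (?S ^ m * cycle_ratio (?X - {i}) (transpose p i \<circ> f)) r"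
        by (simp only:)
      have "fact r * fps_nth (of_nat (card ?X) * (if f i = p
            then ?S ^ m * cycle_ratio (?X - {i}) (transpose p i \<circ> f) else 0)) r
          = of_nat (Suc (Suc m))
            * (fact r * fps_nth (?S ^ m * cycle_ratio (?X - {i}) (transpose p i \<circ> f)) r)"
        by (simp only: True refl if_True X(4) fps_nth_of_nat_mult mult.left_commute)
      also have "\<dots> = fact (Suc (card T))
            * real (card (star_words p r (T - {i}) (transpose p i \<circ> f)))"
        unfolding IH[symmetric] m fact_Suc[of "Suc m"] by (simp only: mult.assoc)
      finally show ?thesis .
    next
      case False
      have "star_words p r (T - {i}) (transpose p i \<circ> f) = {}"
      proof (rule ccontr)
        assume "star_words p r (T - {i}) (transpose p i \<circ> f) \<noteq> {}"
        then have "(transpose p i \<circ> f) i = i"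
          using star_words_fixpoint[of _ p r "T - {i}" "transpose p i \<circ> f" i] i prems(2) by blast
        then show False using False by (auto simp: transpose_def split: if_splits)
      qed
      then show ?thesis using False by simp
    qed
    let ?F = "?S ^ card T * cycle_ratio ?X f"
    have "fact (Suc r) * fps_nth ?F (Suc r) = fact r * fps_nth (fps_deriv ?F) r"
      by (simp add: fps_deriv_nth del: fps_deriv_mult)
    also have "\<dots> = (\<Sum>i\<in>T. fact r * fps_nth (?S ^ Suc m * cycle_ratio ?X (transpose p i \<circ> f)) r
        + fact r * fps_nth (of_nat (card ?X) * (if f i = p
            then ?S ^ m * cycle_ratio (?X - {i}) (transpose p i \<circ> f) else 0)) r)"
      unfolding m deriv_star_series[OF X(1) prems(3) X(2,4)] X(3)
      by (simp only: fps_sum_nth sum_distrib_left fps_add_nth distrib_left)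
    also have "\<dots> = (\<Sum>i\<in>T. fact (Suc (card T)) * real (card (star_words p r T (transpose p i \<circ> f)))
        + fact (Suc (card T)) * real (card (star_words p r (T - {i}) (transpose p i \<circ> f))))"
      by (intro sum.cong refl arg_cong2[of _ _ _ _ "(+)"] first last)
    also have "\<dots> = fact (Suc (card T)) * real (card (star_words p (Suc r) T f))"
      by (simp only: card_star_words_Suc[OF prems(1)] of_nat_sum of_nat_add sum_distrib_left distrib_left)
    finally show ?thesis by simp
  qed
qed

lemma cycle_type_eq_full_cycle_iff:
  assumes "N \<ge> 1" "f permutes {1..N}"
  shows "cycle_type N f = {#N#} \<longleftrightarrow> orbit f ` {1..N} = {orbit f 1}"
proof
  assume "cycle_type N f = {#N#}"
  then have "size (cycle_type N f) = 1" by simp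
  then have "card (orbit f ` {1..N}) = 1" by (simp add: cycle_type_def)
  then obtain c where "orbit f ` {1..N} = {c}" by (auto simp: card_1_singleton_iff)
  moreover have "orbit f 1 \<in> orbit f ` {1..N}" using assms(1) by simp
  ultimately show "orbit f ` {1..N} = {orbit f 1}" by simp
next
  assume single: "orbit f ` {1..N} = {orbit f 1}"
  have "{z \<in> {1..N}. orbit f z = orbit f 1} = orbit f 1"
    using assms by (intro fibre_orbit) auto
  then have "orbit f 1 = {1..N}" using single by blast
  then show "cycle_type N f = {#N#}" unfolding cycle_type_def single by simp
qed

text \<open>A single cycle gives \<open>sinh_ratio N\<close> with constant term N; every further
  cycle contributes a sine with constant term 0. This is the initial condition of the differential
  equation.\<close>

lemma cycle_ratio_nth_0:
  assumes "N \<ge> 1" "f permutes {1..N}"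
  shows "fps_nth (cycle_ratio {1..N} f) 0 = (if cycle_type N f = {#N#} then real N else 0)"
proof (cases "cycle_type N f = {#N#}")
  case True
  then have single: "orbit f ` {1..N} = {orbit f 1}"
    using cycle_type_eq_full_cycle_iff[OF assms] by simp
  have "card (orbit f 1) = N" using True unfolding cycle_type_def single by simp
  then show ?thesis
    using assms(1) True cycle_ratio_split[of "{1..N}" 1 f]
    by (simp add: cycle_prod_except_def single[simplified] sinh_ratio_nth_0)
next
  case False
  then have "orbit f ` {1..N} \<noteq> {orbit f 1}"
    using cycle_type_eq_full_cycle_iff[OF assms] by simp
  moreover have "orbit f 1 \<in> orbit f ` {1..N}" using assms(1) by simp
  ultimately obtain c where c: "c \<in> orbit f ` {1..N} - {orbit f 1}" by blast
  have "fps_nth (cycle_prod_except {1..N} f 1) 0 = 0"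
    unfolding cycle_prod_except_def by (subst prod.remove[OF _ c]) simp_all
  then show ?thesis
    using assms(1) False cycle_ratio_split[of "{1..N}" 1 f] by (simp del: One_nat_def)
qed

lemma cycle_words_0:
  "f permutes {1..N} \<Longrightarrow> cycle_words N 0 f = (if cycle_type N f = {#N#} then {([], f)} else {})"
  by (auto simp: cycle_words_def conj_class_def sym_group_carrier)

text \<open>Induction on s by removal of the first transposition. The factor N in
  \<open>deriv_cycle_series\<close> accumulates to \<open>real N ^ s\<close>, the substitution of N
  t for t.\<close>

lemma card_cycle_words:
  assumes "N \<ge> 1" "f permutes {1..N}"
  shows "real N * real (card (cycle_words N s f))
    = real N ^ s * fact s * fps_nth (cycle_ratio {1..N} f) s"
  using assms(2)
proof (induction s arbitrary: f)
  case (0 f)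
  then show ?case by (simp add: cycle_ratio_nth_0[OF assms(1)] cycle_words_0 del: One_nat_def)
next
  case (Suc s f)
  have "2 * (real N * real (card (cycle_words N (Suc s) f)))
      = real N * (2 * (\<Sum>t\<in>transpositions N. real (card (cycle_words N s (t \<circ> f)))))"
    by (simp add: card_cycle_words_Suc)
  also have "\<dots> = (\<Sum>x\<in>{1..N}. \<Sum>y\<in>{1..N} - {x}.
      real N * real (card (cycle_words N s (transpose x y \<circ> f))))"
    by (subst sum_transpositions) (simp only: sum_distrib_left)
  also have "\<dots> = (\<Sum>x\<in>{1..N}. \<Sum>y\<in>{1..N} - {x}.
      real N ^ s * fact s * fps_nth (cycle_ratio {1..N} (transpose x y \<circ> f)) s)"
    by (intro sum.cong refl Suc.IH permutes_comp_transpose Suc.prems) auto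
  also have "\<dots> = real N ^ s * fact s * fps_nth
      (\<Sum>x\<in>{1..N}. \<Sum>y\<in>{1..N} - {x}. cycle_ratio {1..N} (transpose x y \<circ> f)) s"
    by (simp only: fps_sum_nth sum_distrib_left)
  also have "\<dots> = real N ^ s * fact s * fps_nth (of_nat (2 * N) * fps_deriv (cycle_ratio {1..N} f)) s"
    using deriv_cycle_series[OF _ Suc.prems] by simp
  also have "\<dots> = 2 * (real N ^ Suc s * fact (Suc s) * fps_nth (cycle_ratio {1..N} f) (Suc s))"
    unfolding fps_nth_of_nat_mult by simp
  finally show ?case by simp
qed

section \<open>Comparison of the two counts\<close>

text \<open>Additional parts of the cycle type thus become additional factors, which relates
  permutations of sets of different sizes.\<close>

lemma cycle_prod_cycle_type:
  "cycle_prod {1..n} f = prod_mset (image_mset two_sinh (cycle_type n f))"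
  by (simp add: cycle_prod_def cycle_type_def prod_unfold_prod_mset image_mset.compositionality o_def)

lemma star_factorizations_eq_image:
  assumes "n \<ge> 1"
  shows "star_factorizations g n \<alpha> s
    = map (transpose n) ` star_words n (n + size \<alpha> - 2 + 2 * g) {1..n - 1} s"
proof (intro equalityI subsetI)
  fix ts assume ts: "ts \<in> star_factorizations g n \<alpha> s"
  then have "set ts \<subseteq> transpose n ` {1..n - 1}"
    by (auto simp: star_factorizations_def star_transpositions_def transpose_commute[of n])
  then have "ts \<in> map (transpose n) ` lists {1..n - 1}"
    by (simp add: in_lists_conv_set subset_iff flip: lists_image)
  then obtain xs where xs: "set xs \<subseteq> {1..n - 1}" "ts = map (transpose n) xs"
    by (auto simp: lists_eq_set)
  then have "set xs = {1..n - 1}"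
    using ts transitive_star_iff[OF xs(1) assms] by (simp add: star_factorizations_def)
  then show "ts \<in> map (transpose n) ` star_words n (n + size \<alpha> - 2 + 2 * g) {1..n - 1} s"
    using ts xs(2) by (auto simp: star_factorizations_def star_words_def)
next
  fix ts assume "ts \<in> map (transpose n) ` star_words n (n + size \<alpha> - 2 + 2 * g) {1..n - 1} s"
  then obtain xs where xs: "ts = map (transpose n) xs" "set xs = {1..n - 1}"
      "length xs = n + size \<alpha> - 2 + 2 * g" "perm_product ts = s"
    by (auto simp: star_words_def)
  moreover have "transpose n ` {1..n - 1} \<subseteq> star_transpositions n"
    by (auto simp: star_transpositions_def transpose_commute)
  ultimately show "ts \<in> star_factorizations g n \<alpha> s"
    using transitive_star_iff[OF order_refl assms] by (simp add: star_factorizations_def)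
qed

theorem corollary1p4:
  fixes g n m :: nat and \<alpha> :: "nat multiset" and \<sigma> \<rho> :: "nat \<Rightarrow> nat"
  assumes "n \<ge> 1"
    and "is_partition \<alpha> n"
    and "size \<alpha> = m"
    and "\<sigma> \<in> conj_class n \<alpha>"
    and "\<rho> \<in> conj_class (2 * n - 1) (\<alpha> + replicate_mset (n - 1) 1)"
  shows "real (card (star_factorizations g n \<alpha> \<sigma>)) =
    1 / (fact n * (2 * real n - 1) powi (int n + int m - 3 + 2 * int g)) *
    real (card (cycle_factorizations g (2 * n - 1) (\<alpha> + replicate_mset (n - 1) 1) \<rho>))"
proof -
  define r where "r = n + m - 2 + 2 * g"
  define N where "N = 2 * n - 1"
  \<comment> \<open>Since n and m are positive, the subtraction in \<open>r\<close> is
    exact.\<close>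
  have "\<alpha> \<noteq> {#}" using assms(1,2) by (auto simp: is_partition_def)
  then have m: "m \<ge> 1" using assms(3) by (cases m) auto
  have N: "N \<ge> 1" "real N = 2 * real n - 1" using assms(1) by (auto simp: N_def)
  have \<sigma>: "\<sigma> permutes {1..n}" "cycle_type n \<sigma> = \<alpha>"
    using assms(4) by (auto simp: conj_class_def sym_group_carrier)
  have \<rho>: "\<rho> permutes {1..N}" "cycle_type N \<rho> = \<alpha> + replicate_mset (n - 1) 1"
    using assms(5) by (auto simp: conj_class_def sym_group_carrier N_def)
  have "two_sinh 1 * cycle_ratio {1..N} \<rho> = cycle_prod {1..N} \<rho>"
    using N(1) by (intro two_sinh_mult_cycle_ratio[of _ 1]) auto
  also have "\<dots> = two_sinh 1 ^ (n - 1) * cycle_prod {1..n} \<sigma>"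
    unfolding cycle_prod_cycle_type \<sigma>(2) \<rho>(2) by simp
  also have "cycle_prod {1..n} \<sigma> = two_sinh 1 * cycle_ratio {1..n} \<sigma>"
    using assms(1) by (intro two_sinh_mult_cycle_ratio[symmetric, of _ 1]) auto
  \<comment> \<open>The n - 1 added fixed points supply exactly the power of
    \<open>two_sinh 1\<close> that occurs in the series of star words.\<close>
  finally have ratio: "cycle_ratio {1..N} \<rho> = two_sinh 1 ^ (n - 1) * cycle_ratio {1..n} \<sigma>"
    by (simp add: two_sinh_nz)

  have "inj_on (map (transpose n)) A" for A
  proof (rule inj_on_subset[OF inj_mapI subset_UNIV])
    show "inj (transpose n :: nat \<Rightarrow> _)" by (rule injI) (metis transpose_apply_first)
  qed
  then have "card (star_factorizations g n \<alpha> \<sigma>) = card (star_words n r {1..n - 1} \<sigma>)"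
    by (simp add: star_factorizations_eq_image[OF assms(1)] card_image r_def assms(3))
  moreover have "insert n {1..n - 1} = {1..n}" using assms(1) by auto
  ultimately have star: "fact n * real (card (star_factorizations g n \<alpha> \<sigma>))
      = fact r * fps_nth (cycle_ratio {1..N} \<rho>) r"
    using card_star_words[of "{1..n - 1}" n \<sigma> r] assms(1) \<sigma>(1) unfolding ratio by simp

  \<comment> \<open>The n - 1 additional parts make both kinds of factorization use the same number
    r of transpositions.\<close>
  have "size (\<alpha> + replicate_mset (n - 1) 1) - 1 + 2 * g = r"
    using m assms(1) by (simp only: size_union size_replicate_mset assms(3) r_def)
  then have "cycle_factorizations g (2 * n - 1) (\<alpha> + replicate_mset (n - 1) 1) \<rho> = cycle_words N r \<rho>"
    by (simp only: cycle_factorizations_def cycle_words_def N_def)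
  then have "real N * real (card (cycle_factorizations g (2 * n - 1) (\<alpha> + replicate_mset (n - 1) 1) \<rho>))
      = real N ^ r * (fact n * real (card (star_factorizations g n \<alpha> \<sigma>)))"
    using card_cycle_words[OF N(1) \<rho>(1), of r] star by simp
  \<comment> \<open>The exponent is r - 1, which equals -1 for n = m = 1 and g = 0; hence the
    integer power.\<close>
  moreover have pow: "(2 * real n - 1) powi (int n + int m - 3 + 2 * int g) = real N ^ r / real N"
  proof -
    have exponent: "int n + int m - 3 + 2 * int g = int r - 1" using m assms(1) by (simp add: r_def)
    have "real N powi (int r - 1) = real N ^ r / real N"
      using N(1) power_int_diff[of "real N" "int r" 1] by simp
    then show ?thesis by (simp only: exponent N(2))
  qed
  ultimately show ?thesis using N(1) unfolding pow by (simp add: field_simps)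
qed

end
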